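(* Let $\tilde{\mathcal{B}}$ be the braiding matrix for the fundamental representation of $D_n$ restricted to the span of the $\mathcal{J}_{a,c}$ with $o(a)+o(c)=2n-1$, with unknown coefficients $\beta_{ac}^{db}$. Then for all $a,b,c,d\in I$ with $o(a)<o(b)$ and $o(a)+o(c)=o(b)+o(d)=2n-1$, $$\beta_{ac}^{db}=\begin{cases}(q^{1/2}-q^{-1/2})\,q^{-\frac12(o(a)-o(b))},&(o(a)-n+\frac12)(o(b)-n+\frac12)>0,\\[2pt](q^{1/2}-q^{-1/2})\,q^{-\frac12(o(a)-o(b)+1)}+\delta_{o(a)}^{2n-1-o(b)}(q^{-1/2}-q^{1/2}),&(o(a)-n+\frac12)(o(b)-n+\frac12)<0.\end{cases}$$
   Context: Let $n\ge2$. Scalars are in $\mathbb{C}(t)$, $t$ an indeterminate, $q=t^4$, $q^{k/4}=t^k$. $I=\{0,1,\dots,n-1,(n-1)',n,\dots,2n-2\}$ with order function $o(a)=a$ for $a=0,\dots,n-1$, $o((n-1)')=n$, $o(a)=a+1$ for $a=n,\dots,2n-2$. Let $W$ be the $2n$-dimensional space with basis $\mathcal{J}_{a,c}$, $a,c\in I$, $o(a)+o(c)=2n-1$. $\tilde{\mathcal{B}}:W\to W$ is an invertible linear map with entries $\tilde{\mathcal{B}}\mathcal{J}_{a,c}=\sum\tilde{\mathcal{B}}_{ac}^{bd}\mathcal{J}_{b,d}$, of the form $$\tilde{\mathcal{B}}\mathcal{J}_{a,c}=q^{1/2}\mathcal{J}_{c,a}+\sum_{o(d)<o(c),\ o(d)+o(b)=2n-1}\beta_{ac}^{db}\,\mathcal{J}_{d,b},$$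 and satisfying $$\tilde{\mathcal{B}}_{ac}^{bd}-(\tilde{\mathcal{B}}^{-1})_{ac}^{bd}=(q^{1/2}-q^{-1/2})\left(\mathcal{M}_{ac}\mathcal{M}^{bd}-\delta_a^b\delta_c^d\right),\qquad o(a)+o(c)=o(b)+o(d)=2n-1,$$ where for $o(a)+o(c)=2n-1$ the fusion matrix is $\mathcal{M}_{ac}=\mathcal{M}^{ac}=q^{\frac{n-1-o(a)}{2}}$ if $0\le o(a)\le n-1$ and $=q^{\frac{n-o(a)}{2}}$ if $n\le o(a)\le 2n-1$. *)

theory Defs
  imports Complex_Main
    "HOL-Computational_Algebra.Polynomial"
    "HOL-Computational_Algebra.Fraction_Field"
begin

type_synonym ratfun = "complex poly fract"

definition tvar :: ratfun where
  "tvar = Fract [:0, 1:] 1"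

definition q :: ratfun where
  "q = tvar ^ 4"

text \<open>All exponents of \<open>q\<close> that occur are half-integers: \<open>qhalf k\<close> is
  \<open>q\<close> to the power \<open>k/2\<close>, under the convention that \<open>t\<close> is the chosen fourth root of \<open>q\<close>.\<close>

definition qhalf :: "int \<Rightarrow> ratfun" where
  "qhalf k = tvar powi (2 * k)"

lemma qhalf_square: "qhalf k ^ 2 = q powi k"
proof -
  have "q powi k = tvar powi (4 * k)"
    unfolding q_def by (simp add: power_int_mult)
  moreover have "qhalf k ^ 2 = tvar powi (2 * k * 2)"
    unfolding qhalf_def by (simp only: power_int_mult power_int_numeral)
  ultimately show ?thesis
    by (simp add: mult.commute)
qed

text \<open>The label \<open>(n-1)'\<close> is \<open>Primed (n - 1)\<close>; no other primed label lies in \<open>labels n\<close>.\<close>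

datatype label = Plain nat | Primed nat

definition labels :: "nat \<Rightarrow> label set" where
  "labels n = Plain ` {0..2 * n - 2} \<union> {Primed (n - 1)}"

fun ordf :: "nat \<Rightarrow> label \<Rightarrow> nat" where
  "ordf n (Plain k) = (if k \<le> n - 1 then k else k + 1)"
| "ordf n (Primed k) = n"

definition label_pairs :: "nat \<Rightarrow> (label \<times> label) set" where
  "label_pairs n = {(a, c). a \<in> labels n \<and> c \<in> labels n \<and> ordf n a + ordf n c = 2 * n - 1}"

lemma ordf_bij_betw:
  assumes "n \<ge> 2"
  shows "bij_betw (ordf n) (labels n) {0..2 * n - 1}"
proof -
  have "inj_on (ordf n) (labels n)"
    using assms by (auto simp: inj_on_def labels_def split: if_splits)
  moreover have "ordf n ` labels n = {0..2 * n - 1}"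
  proof
    show "ordf n ` labels n \<subseteq> {0..2 * n - 1}"
      using assms by (auto simp: labels_def)
    show "{0..2 * n - 1} \<subseteq> ordf n ` labels n"
    proof
      fix x assume x: "x \<in> {0..2 * n - 1}"
      consider "x < n" | "x = n" | "x > n" by linarith
      then show "x \<in> ordf n ` labels n"
      proof cases
        case 1
        then have "x = ordf n (Plain x)" "Plain x \<in> labels n"
          by (auto simp: labels_def)
        then show ?thesis by blast
      next
        case 2
        then have "x = ordf n (Primed (n - 1))" "Primed (n - 1) \<in> labels n"
          by (auto simp: labels_def)
        then show ?thesis by blast
      next
        case 3
        then have "x = ordf n (Plain (x - 1))" "Plain (x - 1) \<in> labels n"
          using x by (auto simp: labels_def)
        then show ?thesis by blast
      qed
    qed
  qed
  ultimately show ?thesis by (simp add: bij_betw_def)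
qed

text \<open>The fusion matrix, with upper and lower indices alike.  It is meaningful only for
  \<open>(a, c) \<in> label_pairs n\<close>, where \<open>c\<close> is determined by \<open>a\<close>.\<close>

definition fusion :: "nat \<Rightarrow> label \<Rightarrow> label \<Rightarrow> ratfun" where
  "fusion n a c =
    (if ordf n a \<le> n - 1 then qhalf (int n - 1 - int (ordf n a))
     else qhalf (int n - int (ordf n a)))"

definition is_basis_family ::
    "('k::field \<Rightarrow> 'w::ab_group_add \<Rightarrow> 'w) \<Rightarrow> 'i set \<Rightarrow> ('i \<Rightarrow> 'w) \<Rightarrow> bool" where
  "is_basis_family scale S J \<longleftrightarrow>
    inj_on J S \<and> \<not> module.dependent scale (J ` S) \<and> module.span scale (J ` S) = UNIV"

text \<open>\<open>entry scale S J f i j\<close> is the coefficient of \<open>J j\<close> in \<open>f (J i)\<close>: the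
  first index is the lower (input) one, the second the upper (output) one.\<close>

definition entry ::
    "('k::field \<Rightarrow> 'w::ab_group_add \<Rightarrow> 'w) \<Rightarrow> 'i set \<Rightarrow> ('i \<Rightarrow> 'w) \<Rightarrow> ('w \<Rightarrow> 'w) \<Rightarrow> 'i \<Rightarrow> 'i \<Rightarrow> 'k"
  where
  "entry scale S J f i j = module.representation scale (J ` S) (f (J i)) (J j)"

lemma entry_expansion:
  assumes "vector_space scale" "is_basis_family scale S J" "finite S"
  shows "f (J i) = (\<Sum>j\<in>S. scale (entry scale S J f i j) (J j))"
proof -
  interpret vector_space scale by fact
  have inj: "inj_on J S" and ind: "independent (J ` S)" and sp: "span (J ` S) = UNIV"
    using assms(2) by (auto simp: is_basis_family_def)
  have "(\<Sum>w\<in>J ` S. scale (representation (J ` S) (f (J i)) w) w) = f (J i)"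
    using ind sp assms(3) by (intro sum_representation_eq) auto
  then show ?thesis
    using inj by (simp add: sum.reindex entry_def)
qed

end

theory Submission
  imports Defs
begin

text \<open>
  Index the basis vector \<open>J (a, c)\<close> by \<open>o(a)\<close>.  By its shape, \<open>B\<close> sends it into the span
  of the vectors of index at most \<open>2n - 1 - o(a)\<close>, with an invertible leading coefficient, so
  \<open>B\<close> is triangular up to reversal of the order.  Its inverse is then triangular in the opposite
  sense: the entries of \<open>inv B\<close> vanish exactly where the coefficients \<open>\<beta>\<close> sit.  There
  the skein relation therefore reads off \<open>\<beta>\<close> from the fusion matrix alone.
\<close>

lemma representation_basis_family:
  assumes "vector_space scale" "is_basis_family scale S J" "i \<in> S" "j \<in> S"
  shows "module.representation scale (J ` S) (J i) (J j) = of_bool (i = j)"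
proof -
  interpret vector_space scale by fact
  have inj: "inj_on J S" and ind: "independent (J ` S)"
    using assms(2) by (auto simp: is_basis_family_def)
  show ?thesis
    using representation_basis[OF ind, of "J i"] assms(3,4) inj
    by (auto simp: inj_on_eq_iff)
qed

text \<open>Makes each coordinate a functional that can be pushed through the expansions of
  \<open>f (J i)\<close> and \<open>inv B (J i)\<close> term by term.\<close>

lemma linear_representation:
  fixes scale :: "'k::field \<Rightarrow> 'w::ab_group_add \<Rightarrow> 'w"
  assumes "vector_space scale" "is_basis_family scale S J"
  shows "Vector_Spaces.linear scale (*) (\<lambda>v. module.representation scale (J ` S) v w)"
proof -
  interpret vector_space scale by fact
  have ind: "independent (J ` S)" and sp: "span (J ` S) = UNIV"
    using assms(2) by (auto simp: is_basis_family_def)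
  interpret F: vector_space "(*) :: 'k \<Rightarrow> 'k \<Rightarrow> 'k"
    by unfold_locales (auto simp: algebra_simps)
  show ?thesis
    by unfold_locales
      (use ind sp in \<open>auto simp: representation_add representation_scale\<close>)
qed

text \<open>The condition \<open>j \<noteq> s i\<close> keeps the leading term, whose coefficient is
  \<open>p\<close>, out of the coordinate at \<open>J j\<close>.\<close>

lemma entry_of_expansion:
  assumes W: "vector_space scale" and basis: "is_basis_family scale S J"
    and s: "s i \<in> S" and T: "T \<subseteq> S" "finite T" and j: "j \<in> T" "j \<noteq> s i"
    and form: "f (J i) = scale p (J (s i)) + (\<Sum>k\<in>T. scale (\<beta> k) (J k))"
  shows "entry scale S J f i j = \<beta> j"
proof -
  interpret \<phi>: Vector_Spaces.linear scale "(*)" "\<lambda>v. module.representation scale (J ` S) v (J j)"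
    by (rule linear_representation[OF W basis])
  have [simp]: "module.representation scale (J ` S) (J k) (J j) = of_bool (k = j)" if "k \<in> S" for k
    using representation_basis_family[OF W basis that] T j by auto
  have "(\<Sum>k\<in>T. \<beta> k * module.representation scale (J ` S) (J k) (J j))
      = (\<Sum>k\<in>T. if k = j then \<beta> k else 0)"
    using T by (intro sum.cong) auto
  then show ?thesis
    using s j T by (simp add: entry_def form \<phi>.add \<phi>.sum \<phi>.scale)
qed

text \<open>Applying \<open>inv B\<close> to the expansion of \<open>B (J (s i))\<close> and solving
  for \<open>inv B (J i)\<close>, which needs \<open>p \<noteq> 0\<close>, leaves
  \<open>J (s i)\<close> and images \<open>inv B (J k)\<close> with \<open>r k < r i\<close>.
  Induction on \<open>r i\<close> handles the latter.\<close>

lemma entry_inv_antitriangular: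
  fixes r :: "'i \<Rightarrow> nat"
  assumes W: "vector_space scale" and basis: "is_basis_family scale S J"
    and lin: "Vector_Spaces.linear scale scale B" and "bij B"
    and s: "\<And>i. i \<in> S \<Longrightarrow> s i \<in> S" "\<And>i. i \<in> S \<Longrightarrow> s (s i) = i"
    and anti: "\<And>i j. i \<in> S \<Longrightarrow> j \<in> S \<Longrightarrow> r i < r j \<Longrightarrow> r (s j) < r (s i)"
    and p: "p \<noteq> 0"
    and form: "\<And>i. i \<in> S \<Longrightarrow>
      B (J i) = scale p (J (s i)) + (\<Sum>k\<in>{k\<in>S. r k < r (s i)}. scale (\<beta> i k) (J k))"
    and "i \<in> S" "j \<in> S" "r j < r (s i)"
  shows "entry scale S J (inv B) i j = 0"
  using \<open>i \<in> S\<close> \<open>r j < r (s i)\<close>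
proof (induction "r i" arbitrary: i rule: less_induct)
  case less
  interpret B: Vector_Spaces.linear scale scale B by fact
  interpret Binv: Vector_Spaces.linear scale scale "inv B"
    by unfold_locales
      (use \<open>bij B\<close> in \<open>auto intro!: inv_f_eq simp: bij_is_inj bij_is_surj surj_f_inv_f B.add B.scale\<close>)
  interpret \<phi>: Vector_Spaces.linear scale "(*)" "\<lambda>v. module.representation scale (J ` S) v (J j)"
    by (rule linear_representation[OF W basis])
  let ?T = "{k\<in>S. r k < r i}"
  \<comment> \<open>The expansion is used at \<open>s i\<close>, not at \<open>i\<close>: as
    \<open>s\<close> is an involution, its leading vector is then \<open>J i\<close> and its tail
    has rank below \<open>r i\<close>.\<close>
  have "J (s i) = inv B (B (J (s i)))"
    using \<open>bij B\<close> by (simp add: bij_is_inj)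
  also have "\<dots> = scale p (inv B (J i)) + (\<Sum>k\<in>?T. scale (\<beta> (s i) k) (inv B (J k)))"
    using less.prems s by (simp add: form Binv.add Binv.sum Binv.scale)
  finally have "module.representation scale (J ` S) (J (s i)) (J j)
      = p * entry scale S J (inv B) i j + (\<Sum>k\<in>?T. \<beta> (s i) k * entry scale S J (inv B) k j)"
    by (simp add: entry_def \<phi>.add \<phi>.sum \<phi>.scale)
  \<comment> \<open>Since \<open>s\<close> reverses ranks, \<open>r j < r (s i) < r (s k)\<close>,
    so the induction hypothesis covers \<open>k\<close>.\<close>
  moreover have "entry scale S J (inv B) k j = 0" if "k \<in> ?T" for k
    using that less anti[of k i] by force
  moreover have "module.representation scale (J ` S) (J (s i)) (J j) = 0"
    using less.prems s \<open>j \<in> S\<close> by (auto simp: representation_basis_family[OF W basis])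
  ultimately show ?case using p by simp
qed

lemma tvar_nonzero: "tvar \<noteq> 0"
  by (simp add: tvar_def Zero_fract_def eq_fract)

lemma qhalf_nonzero: "qhalf k \<noteq> 0"
  by (simp add: qhalf_def tvar_nonzero)

lemma qhalf_add: "qhalf (k + l) = qhalf k * qhalf l"
  by (simp add: qhalf_def distrib_left power_int_add tvar_nonzero)

lemma finite_label_pairs: "finite (label_pairs n)"
  by (rule finite_subset[of _ "labels n \<times> labels n"]) (auto simp: label_pairs_def labels_def)

text \<open>Each factor has exponent \<open>n\<close> minus the order, less one more if the order is
  below \<open>n\<close>. Among \<open>a\<close> and \<open>d\<close> both orders lie below
  \<open>n\<close> exactly in the first case, and just one does otherwise.\<close>

lemma fusion_mult_fusion:
  assumes "n \<ge> 1" "ordf n a < ordf n b" "ordf n b + ordf n d = 2 * n - 1"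
  shows "fusion n a c * fusion n d b =
    (if ordf n a < n \<and> n \<le> ordf n b then qhalf (int (ordf n b) - int (ordf n a) - 1)
     else qhalf (int (ordf n b) - int (ordf n a)))"
proof -
  have "int (ordf n d) = 2 * int n - 1 - int (ordf n b)"
    using assms by linarith
  then show ?thesis
    using assms by (auto simp: fusion_def simp flip: qhalf_add intro!: arg_cong[of _ _ qhalf])
qed

theorem theorem4p29:
  fixes n :: nat
    and scale :: "ratfun \<Rightarrow> 'w::ab_group_add \<Rightarrow> 'w"
    and J :: "label \<times> label \<Rightarrow> 'w"
    and B :: "'w \<Rightarrow> 'w"
    and \<beta> :: "label \<times> label \<Rightarrow> label \<times> label \<Rightarrow> ratfun"
  assumes n: "n \<ge> 2"
    and W: "vector_space scale"
    and basis: "is_basis_family scale (label_pairs n) J"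
    and lin: "Vector_Spaces.linear scale scale B"
    and invertible: "bij B"
    and form: "\<And>a c. (a, c) \<in> label_pairs n \<Longrightarrow>
      B (J (a, c)) = scale (qhalf 1) (J (c, a))
        + (\<Sum>(d, b)\<in>{(d, b). (d, b) \<in> label_pairs n \<and> ordf n d < ordf n c}.
             scale (\<beta> (a, c) (d, b)) (J (d, b)))"
    and skein: "\<And>a c b d. (a, c) \<in> label_pairs n \<Longrightarrow> (b, d) \<in> label_pairs n \<Longrightarrow>
      entry scale (label_pairs n) J B (a, c) (b, d)
        - entry scale (label_pairs n) J (inv B) (a, c) (b, d)
      = (qhalf 1 - qhalf (-1))
          * (fusion n a c * fusion n b d - of_bool (a = b) * of_bool (c = d))"
  shows "\<forall>a\<in>labels n. \<forall>b\<in>labels n. \<forall>c\<in>labels n. \<forall>d\<in>labels n.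
    ordf n a < ordf n b \<longrightarrow> ordf n a + ordf n c = 2 * n - 1 \<longrightarrow> ordf n b + ordf n d = 2 * n - 1 \<longrightarrow>
      ((real (ordf n a) - real n + 1/2) * (real (ordf n b) - real n + 1/2) > 0 \<longrightarrow>
        \<beta> (a, c) (d, b) =
          (qhalf 1 - qhalf (-1)) * qhalf (- (int (ordf n a) - int (ordf n b)))) \<and>
      ((real (ordf n a) - real n + 1/2) * (real (ordf n b) - real n + 1/2) < 0 \<longrightarrow>
        \<beta> (a, c) (d, b) =
          (qhalf 1 - qhalf (-1)) * qhalf (- (int (ordf n a) - int (ordf n b) + 1))
          + of_bool (int (ordf n a) = 2 * int n - 1 - int (ordf n b)) * (qhalf (-1) - qhalf 1))"
proof (intro ballI impI)
  fix a b c d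
  assume lab: "a \<in> labels n" "b \<in> labels n" "c \<in> labels n" "d \<in> labels n"
    and less: "ordf n a < ordf n b"
    and ac: "ordf n a + ordf n c = 2 * n - 1" and bd: "ordf n b + ordf n d = 2 * n - 1"
  let ?S = "label_pairs n"
  let ?r = "\<lambda>i :: label \<times> label. ordf n (fst i)"
  have mem: "(a, c) \<in> ?S" "(d, b) \<in> ?S"
    using lab ac bd by (auto simp: label_pairs_def)
  have dc: "ordf n d < ordf n c"
    using less ac bd by linarith
  \<comment> \<open>Rank a pair by the order of its first label; the cutoff \<open>ordf n c\<close>
    is then the rank of the swapped pair, and swapping reverses ranks because the two orders have a
    fixed sum.\<close>
  have form': "B (J i) = scale (qhalf 1) (J (prod.swap i))
      + (\<Sum>k\<in>{k\<in>?S. ?r k < ?r (prod.swap i)}. scale (\<beta> i k) (J k))" if "i \<in> ?S" for i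
  proof -
    obtain x y where i: "i = (x, y)" by (cases i)
    have "{(d, b). (d, b) \<in> ?S \<and> ordf n d < ordf n y} = {k\<in>?S. ?r k < ordf n y}"
      by auto
    then show ?thesis
      using form[of x y] that unfolding i by (simp add: case_prod_unfold)
  qed
  have "entry scale ?S J B (a, c) (d, b) = \<beta> (a, c) (d, b)"
    by (rule entry_of_expansion[OF W basis, where f = B and s = prod.swap and \<beta> = "\<beta> (a, c)", OF _ _ _ _ _ form'[OF mem(1)]])
      (use mem dc in \<open>auto simp: label_pairs_def add.commute intro: finite_subset[OF _ finite_label_pairs]\<close>)
  moreover have "entry scale ?S J (inv B) (a, c) (d, b) = 0"
    by (rule entry_inv_antitriangular[where r = ?r, OF W basis lin invertible
          _ _ _ qhalf_nonzero form'])
      (use mem dc in \<open>auto simp: label_pairs_def\<close>)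
  moreover have "a = d \<and> c = b \<longleftrightarrow> ordf n a = ordf n d"
  proof -
    have "inj_on (ordf n) (labels n)"
      using ordf_bij_betw[OF n] by (rule bij_betw_imp_inj_on)
    moreover have "ordf n a = ordf n d \<longleftrightarrow> ordf n c = ordf n b"
      using ac bd by linarith
    ultimately show ?thesis
      using lab by (auto dest: inj_onD)
  qed
  ultimately have \<beta>: "\<beta> (a, c) (d, b) = (qhalf 1 - qhalf (-1)) *
      (fusion n a c * fusion n d b - of_bool (ordf n a = ordf n d))"
    \<comment> \<open>The upper pair of the skein relation is \<open>(d, b)\<close> here, so its
      Kronecker deltas compare \<open>a\<close> with \<open>d\<close> and \<open>c\<close> with
      \<open>b\<close>.\<close>
    using skein[OF mem] by (simp flip: of_bool_conj)
  have delta: "ordf n a = ordf n d \<longleftrightarrow> int (ordf n a) = 2 * int n - 1 - int (ordf n b)"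
    using bd n by linarith
  \<comment> \<open>The shift by 1/2 puts the zero strictly between \<open>n - 1\<close> and
    \<open>n\<close>, so neither factor ever vanishes.\<close>
  have sign: "real k - real n + 1/2 < 0 \<longleftrightarrow> k < n" "real k - real n + 1/2 > 0 \<longleftrightarrow> n \<le> k" for k
    by linarith+
  have split: "(real (ordf n a) - real n + 1/2) * (real (ordf n b) - real n + 1/2) < 0
      \<longleftrightarrow> ordf n a < n \<and> n \<le> ordf n b"
    "(real (ordf n a) - real n + 1/2) * (real (ordf n b) - real n + 1/2) > 0
      \<longleftrightarrow> \<not> (ordf n a < n \<and> n \<le> ordf n b)"
    unfolding mult_less_0_iff zero_less_mult_iff sign using less by auto
  \<comment> \<open>Equality would make the orders of \<open>a\<close> and \<open>b\<close> sum to
    \<open>2 * n - 1\<close>, forcing them to opposite sides of the middle; hence no delta term in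
    the same-sign case.\<close>
  have "ordf n a \<noteq> ordf n d" if "\<not> (ordf n a < n \<and> n \<le> ordf n b)"
    using that less bd by linarith
  moreover have "n \<ge> 1"
    using n by simp
  ultimately show "((real (ordf n a) - real n + 1/2) * (real (ordf n b) - real n + 1/2) > 0 \<longrightarrow>
        \<beta> (a, c) (d, b) =
          (qhalf 1 - qhalf (-1)) * qhalf (- (int (ordf n a) - int (ordf n b)))) \<and>
      ((real (ordf n a) - real n + 1/2) * (real (ordf n b) - real n + 1/2) < 0 \<longrightarrow>
        \<beta> (a, c) (d, b) =
          (qhalf 1 - qhalf (-1)) * qhalf (- (int (ordf n a) - int (ordf n b) + 1))
          + of_bool (int (ordf n a) = 2 * int n - 1 - int (ordf n b)) * (qhalf (-1) - qhalf 1))"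
    unfolding split \<beta> delta[symmetric] fusion_mult_fusion[OF \<open>n \<ge> 1\<close> less bd]
    by (auto simp: algebra_simps)
qed

end
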